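(* Let $\rho=2\cos(\pi/9)$. For a real symmetric matrix $M\in\mathbb{R}^{n\times n}$ ($n\geq1$) and a coordinate $v\in\{1,\dots,n\}$, let $\widehat M_v$ be the $(n+3)\times(n+3)$ matrix $$\widehat M_v=\begin{pmatrix} M & e_v & 0 & 0\\ e_v^{\mathsf T} & 0 & 1 & 0\\ 0 & 1 & 0 & 1\\ 0 & 0 & 1 & 0\end{pmatrix}.$$ The interval $(1,\rho]$ is optimal among intervals contained in $(1,\rho]$ for the property of containing an eigenvalue of $\widehat M_v$ for every $M$ and $v$; that is, no proper interval of the form $(a,b]\subsetneq(1,\rho]$ contains an eigenvalue of $\widehat M_v$ for every real symmetric matrix $M$ (of every size) and every coordinate $v$.
   Context: $e_v$ denotes the $v$-th standard coordinate vector of $\mathbb{R}^n$. *)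

theory Defs
  imports Complex_Main "Jordan_Normal_Form.Char_Poly"
begin

definition rho :: real where
  "rho = 2 * cos (pi / 9)"

definition P3_mat :: "real mat" where
  "P3_mat = mat_of_rows_list 3
     [[0, 1, 0],
      [1, 0, 1],
      [0, 1, 0]]"

definition coupling_mat :: "nat \<Rightarrow> nat \<Rightarrow> real mat" where
  "coupling_mat n v = mat_of_cols n [unit_vec n v, 0\<^sub>v n, 0\<^sub>v n]"

(* Indices are 0-based: the coordinates of an n x n matrix are v < n. *)
definition M_hat :: "real mat \<Rightarrow> nat \<Rightarrow> real mat" where
  "M_hat M v =
     four_block_mat
       M                                             (coupling_mat (dim_row M) v)
       (transpose_mat (coupling_mat (dim_row M) v))  P3_mat"

end

theory Submission
  imports Defs
begin

text \<open>The \<open>1 \<times> 1\<close> matrix \<open>(a)\<close> with the left endpoint itself as entry is a counterexample for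
  every proper subinterval \<open>(a,b]\<close> of \<open>(1,\<rho>]\<close>. Its extension has characteristic polynomial
  \<open>(x - 1)(x\<^sup>3 - 3x - 1) - (a - 1)(x\<^sup>3 - 2x)\<close>, and \<open>\<rho>\<close> is the largest root of \<open>x\<^sup>3 - 3x - 1\<close>.
  For \<open>a = 1\<close> the roots in \<open>[1,\<rho>]\<close> are exactly the two endpoints; for \<open>a > 1\<close> the root \<open>1\<close> moves
  right but stays below \<open>a\<close>, while \<open>\<rho>\<close> moves right and leaves the interval.\<close>

text \<open>The triple-angle formula at pi/9, doubled, using cos(pi/3) = 1/2.\<close>

lemma rho_cubic: "rho ^ 3 - 3 * rho - 1 = 0"
  using cos_treble_cos[of "pi / 9"] by (simp add: rho_def cos_60 power_mult_distrib)

lemma rho_ge_1: "rho \<ge> 1"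
  using cos_monotone_0_pi_le[of "pi / 9" "pi / 3"] by (simp add: rho_def cos_60)

lemma cubic_factor_rho:
  fixes x :: real
  shows "x ^ 3 - 3 * x - 1 = (x - rho) * (x\<^sup>2 + x * rho + rho\<^sup>2 - 3)"
  using rho_cubic by (simp add: algebra_simps power2_eq_square power3_eq_cube)

text \<open>Makes the sign of x^3 - 3x - 1 for x > 1 that of \<open>x - rho\<close>.\<close>

lemma cubic_cofactor_pos:
  fixes x :: real
  assumes "x > 1"
  shows "x\<^sup>2 + x * rho + rho\<^sup>2 - 3 > 0"
proof -
  have "x\<^sup>2 > 1" "rho\<^sup>2 \<ge> 1"
    using assms rho_ge_1 by (simp_all add: one_less_power)
  moreover have "x * rho \<ge> 1 * 1"
    using assms rho_ge_1 by (intro mult_mono) auto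
  ultimately show ?thesis by linarith
qed

text \<open>The factor x^3 - 2x changes sign at x^2 = 2, hence the case split. The last hypothesis
  excludes a = 1 together with x = \<open>rho\<close>, where the value is 0.\<close>

lemma char_poly_neg:
  fixes a x :: real
  assumes "1 \<le> a" "a < x" "x \<le> rho" "1 < a \<or> x < rho"
  shows "(x - 1) * (x ^ 3 - 3 * x - 1) - (a - 1) * (x ^ 3 - 2 * x) < 0"
proof (cases "x\<^sup>2 \<le> 2")
  case True
  have "x * (x\<^sup>2 - 3) \<le> x * (- 1)"
    using True assms by (intro mult_left_mono) auto
  moreover have "x ^ 3 - 3 * x = x * (x\<^sup>2 - 3)"
    by (simp add: algebra_simps power2_eq_square power3_eq_cube)
  ultimately have "x ^ 3 - 3 * x - 1 \<le> - 2"
    using assms by linarith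
  then have "(x - 1) * (x ^ 3 - 3 * x - 1) \<le> (x - 1) * (- 2)"
    using assms by (intro mult_left_mono) auto
  \<comment> \<open>This product is x^3 - 2x + 1. The subtracted term thus adds at most a - 1 < x -
    1, which the bound -2(x - 1) outweighs.\<close>
  moreover have "(x - 1) * (x\<^sup>2 + x - 1) \<ge> 0"
    using assms by (intro mult_nonneg_nonneg) (auto simp: add_increasing)
  then have "x ^ 3 - 2 * x \<ge> - 1"
    by (simp add: algebra_simps power2_eq_square power3_eq_cube)
  then have "(a - 1) * (x ^ 3 - 2 * x) \<ge> (a - 1) * (- 1)"
    using assms by (intro mult_left_mono) auto
  ultimately have "(x - 1) * (x ^ 3 - 3 * x - 1) - (a - 1) * (x ^ 3 - 2 * x)
      \<le> (x - 1) * (- 2) - (a - 1) * (- 1)"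
    by (rule diff_mono)
  also have "\<dots> < 0" using assms by simp
  finally show ?thesis .
next
  case False
  have "x ^ 3 - 2 * x = x * (x\<^sup>2 - 2)"
    by (simp add: algebra_simps power2_eq_square power3_eq_cube)
  then have pos: "x ^ 3 - 2 * x > 0" using False assms by simp
  have q: "x\<^sup>2 + x * rho + rho\<^sup>2 - 3 > 0" using assms by (intro cubic_cofactor_pos) simp
  show ?thesis
  \<comment> \<open>Both terms now contribute with sign \<le> 0; strictness comes from the second if
    a > 1, and from x < \<open>rho\<close> in the first if a = 1.\<close>
  proof (cases "1 < a")
    case True
    have "(x - 1) * (x ^ 3 - 3 * x - 1) \<le> 0"
      unfolding cubic_factor_rho using q assms
      by (intro mult_nonneg_nonpos mult_nonpos_nonneg) auto
    moreover have "(a - 1) * (x ^ 3 - 2 * x) > 0" using True pos by simp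
    ultimately show ?thesis by linarith
  next
    case False
    have "(x - 1) * (x ^ 3 - 3 * x - 1) < 0"
      unfolding cubic_factor_rho using q assms False
      by (intro mult_pos_neg mult_neg_pos) auto
    moreover have "a = 1" using False assms by simp
    ultimately show ?thesis by simp
  qed
qed

lemma M_hat_1x1:
  "M_hat (mat 1 1 (\<lambda>_. a)) 0 = mat_of_rows_list 4
     [[a, 1, 0, 0],
      [1, 0, 1, 0],
      [0, 1, 0, 1],
      [0, 0, 1, 0]]"
  by (rule eq_matI)
    (auto simp: M_hat_def P3_mat_def coupling_mat_def mat_of_rows_list_def mat_of_cols_def
      less_Suc_eq numeral_eq_Suc)

text \<open>Reading the eigenvector equations from the last row upwards expresses every coordinate
  as a polynomial in x times \<open>w $ 3\<close>; the first row is then the characteristic equation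
  times \<open>w $ 3\<close>.\<close>

lemma eigenvalue_M_hat_1x1:
  assumes "eigenvalue (M_hat (mat 1 1 (\<lambda>_. a)) 0) x"
  shows "(x - 1) * (x ^ 3 - 3 * x - 1) - (a - 1) * (x ^ 3 - 2 * x) = 0"
proof -
  let ?A = "mat_of_rows_list 4 [[a, 1, 0, 0], [1, 0, 1, 0], [0, 1, 0, 1], [0, 0, 1, 0]]"
  have dim: "dim_row ?A = 4" "dim_col ?A = 4" by (auto simp: mat_of_rows_list_def)
  obtain w where w: "w \<in> carrier_vec 4" "w \<noteq> 0\<^sub>v 4" "?A *\<^sub>v w = x \<cdot>\<^sub>v w"
    using assms unfolding M_hat_1x1 eigenvalue_def eigenvector_def dim by auto
  have eq: "(?A *\<^sub>v w) $ i = x * w $ i" if "i < 4" for i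
    using that w by simp
  have rows: "a * w $ 0 + w $ 1 = x * w $ 0" "w $ 0 + w $ 2 = x * w $ 1"
    "w $ 1 + w $ 3 = x * w $ 2" "w $ 2 = x * w $ 3"
    using eq[of 0] eq[of 1] eq[of 2] eq[of 3] w(1)
    by (auto simp: mat_of_rows_list_def scalar_prod_def numeral_eq_Suc)
  have "w $ 1 = x * w $ 2 - w $ 3"
    using rows(3) by linarith
  then have w1: "w $ 1 = (x\<^sup>2 - 1) * w $ 3"
    using rows(4) by (simp add: algebra_simps power2_eq_square)
  have "w $ 0 = x * w $ 1 - w $ 2"
    using rows(2) by linarith
  then have w0: "w $ 0 = (x ^ 3 - 2 * x) * w $ 3"
    unfolding w1 rows(4) by (simp add: algebra_simps power2_eq_square power3_eq_cube)
  have "w $ 3 \<noteq> 0"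
  proof
    assume "w $ 3 = 0"
    then have "w $ i = 0" if "i < 4" for i
      using that rows(4) w0 w1 by (auto simp: less_Suc_eq numeral_eq_Suc)
    then have "w = 0\<^sub>v 4" using w(1) by (intro eq_vecI) auto
    with w(2) show False by simp
  qed
  moreover have "((x - 1) * (x ^ 3 - 3 * x - 1) - (a - 1) * (x ^ 3 - 2 * x)) * w $ 3
      = (x - a) * w $ 0 - w $ 1"
    unfolding w0 w1 by (simp add: algebra_simps power2_eq_square power3_eq_cube)
  moreover have "(x - a) * w $ 0 - w $ 1 = 0"
    using rows(1) by (simp add: left_diff_distrib)
  ultimately show ?thesis by simp
qed

theorem proposition2p2:
  shows "\<not> (\<exists>a b :: real. {a<..b} \<subset> {1<..rho} \<and>
    (\<forall>(n :: nat) (M :: real mat) (v :: nat).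
       n \<ge> 1 \<longrightarrow> M \<in> carrier_mat n n \<longrightarrow> transpose_mat M = M \<longrightarrow> v < n \<longrightarrow>
       (\<exists>x \<in> {a<..b}. eigenvalue (M_hat M v) x)))"
proof (intro notI, elim exE conjE)
  fix a b :: real
  assume sub: "{a<..b} \<subset> {1<..rho}"
    and all: "\<forall>(n :: nat) (M :: real mat) (v :: nat).
       n \<ge> 1 \<longrightarrow> M \<in> carrier_mat n n \<longrightarrow> transpose_mat M = M \<longrightarrow> v < n \<longrightarrow>
       (\<exists>x \<in> {a<..b}. eigenvalue (M_hat M v) x)"
  have "transpose_mat (mat 1 1 (\<lambda>_. a)) = mat 1 1 (\<lambda>_. a)"
    by (rule eq_matI) auto
  then obtain x where x: "a < x" "x \<le> b" "eigenvalue (M_hat (mat 1 1 (\<lambda>_. a)) 0) x"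
    using all[rule_format, of 1 "mat 1 1 (\<lambda>_. a)" 0] by auto
  have "{a<..b} \<subseteq> {1<..rho}" "{a<..b} \<noteq> {1<..rho}" using sub by auto
  \<comment> \<open>The point x makes the interval nonempty, so inclusion can be read off at the
    endpoints.\<close>
  then have "1 \<le> a" "b \<le> rho" "a \<noteq> 1 \<or> b \<noteq> rho"
    using x(1,2) by (auto simp: Ioc_subset_iff)
  then have "(x - 1) * (x ^ 3 - 3 * x - 1) - (a - 1) * (x ^ 3 - 2 * x) < 0"
    using x(1,2) by (intro char_poly_neg) auto
  with eigenvalue_M_hat_1x1[OF x(3)] show False by simp
qed

end
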